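(* For any oriented graph $D$, we have $\chi_A(D) \leq \left\lfloor \sqrt{\frac{2}{3}} \cdot \tilde{\Delta}(D) + \frac{7}{5} \right\rfloor$.
   Context: Digraphs are finite, nonempty, without loops and without parallel edges in the same direction. An oriented graph is a digraph in which at most one edge connects any pair of vertices (so there are no directed 2-cycles). For a vertex $v$, $d^+(v)$ and $d^-(v)$ are its out-degree and in-degree. $\tilde{\Delta}(D) = \max_{v \in V(D)} \sqrt{d^+(v)\,d^-(v)}$ is the maximum geometric mean of the in-degree and out-degree of a vertex. An acyclic set in a digraph is a set of vertices whose induced subgraph contains no directed cycle. $\chi_A(D)$, the digraph chromatic number, is the minimum number of acyclic sets into which $V(D)$ can be partitioned. *)

theory Defs
  imports Complex_Main "HOL-Library.Disjoint_Sets" "Graph_Theory.Graph_Theory"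
begin

text \<open>The library locale \<^locale>\<open>digraph\<close> (finite, loop-free, no parallel arcs) admits the null graph,
  so nonemptiness is required separately.\<close>

locale oriented_graph = digraph G for G :: "('a, 'b) pre_digraph" (structure) +
  assumes verts_nonempty: "verts G \<noteq> {}"
    and at_most_one_arc: "\<lbrakk>e \<in> arcs G; f \<in> arcs G; {tail G e, head G e} = {tail G f, head G f}\<rbrakk> \<Longrightarrow> e = f"

definition max_geom_degree :: "('a, 'b) pre_digraph \<Rightarrow> real" where
  "max_geom_degree G =
     Max ((\<lambda>v. sqrt (real (out_degree G v) * real (in_degree G v))) ` verts G)"

definition acyclic_set :: "('a, 'b) pre_digraph \<Rightarrow> 'a set \<Rightarrow> bool" where
  "acyclic_set G S \<longleftrightarrow> S \<subseteq> verts G \<and> (\<nexists>p. pre_digraph.cycle (G \<restriction> S) p)"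

text \<open>For a finite loop-free digraph the partition into singletons is a witness, so the
  \<^const>\<open>Least\<close> below is a genuine minimum.\<close>

definition digraph_chromatic_number :: "('a, 'b) pre_digraph \<Rightarrow> nat" where
  "digraph_chromatic_number G =
     (LEAST k. \<exists>P. partition_on (verts G) P \<and> finite P \<and> card P = k \<and> (\<forall>S\<in>P. acyclic_set G S))"

end

theory Submission
  imports Defs
begin

text \<open>
  Let \<open>k\<close> be the claimed bound, so that \<open>d\<^sup>+(v) d\<^sup>-(v) < 3/2 (k - 2/5)\<^sup>2\<close> for every vertex; the task is
  to colour with \<open>k\<close> colours. A vertex with fewer than \<open>k\<close> out-neighbours or fewer than \<open>k\<close>
  in-neighbours can be coloured last (\<open>colourable_extend\<close>), so all in- and out-degrees may be assumed to
  be at least \<open>k\<close>. Under that assumption a bound on the product is a bound on the sum: from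
  \<open>(d\<^sup>+ - k)(d\<^sup>- - k) \<ge> 0\<close> one gets \<open>d\<^sup>+ + d\<^sup>- \<le> k + d\<^sup>+ d\<^sup>- / k\<close>, which is below
  \<open>5/2 k - 1/2\<close>, and hence \<open>2 (d\<^sup>+ + d\<^sup>- + 1) \<le> 5 k\<close>. This is where the factor
  \<open>sqrt (2/3)\<close> comes from: a total degree of five halves of \<open>k\<close> corresponds, at the extreme pair
  \<open>(k, 3/2 k)\<close>, to a product of three halves of \<open>k\<^sup>2\<close>.

  A graph of total degree at most about \<open>5/2 k\<close> is handled by splitting the vertex set, in the manner
  of Lovasz, into parts that induce total degree at most 4, and one part of total degree at most 1 if
  \<open>k\<close> is odd (\<open>degree_partition\<close>). Each part of degree 4 uses up five units of degree and needs only
  two colours (\<open>colourable_2_if_total_deg_le_4\<close>); the part of degree 1 uses two units and one colour.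

  That total degree 4 needs only two colours is the case of Brooks' theorem for digraphs that carries the
  proof. In a minimal counterexample every vertex has two in-neighbours and two out-neighbours, and after
  deleting any vertex \<open>h\<close> the rest can be 2-coloured. In such a colouring with a hole at \<open>h\<close>, both colours
  occur among the in-neighbours of \<open>h\<close> and both among its out-neighbours, since otherwise \<open>h\<close> could be
  coloured too. Therefore the hole can be pushed to any neighbour, which hands its colour to \<open>h\<close>.
  Pushing the hole once around a cycle of the underlying undirected graph rotates the colours on that
  cycle; if the cycle enters \<open>h\<close> through just one of the two in-neighbours, the other one forces the colour
  next to \<open>h\<close> to stay the same, so the cycle is monochromatic. A connectivity argument produces a
  cycle of this kind with two colours, a contradiction (\<open>no_hole_colouring\<close>).
\<close>

section \<open>Acyclic relations\<close>

lemma acyclic_if_sink: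
  assumes "acyclic {(x, y) \<in> r. x \<noteq> v \<and> y \<noteq> v}" and "v \<notin> Domain r"
  shows "acyclic r"
proof (rule acyclicI, intro allI notI)
  let ?r = "{(x, y) \<in> r. x \<noteq> v \<and> y \<noteq> v}"
  fix x assume cyc: "(x, x) \<in> r\<^sup>+"
  have "y \<noteq> v \<longrightarrow> (x, y) \<in> ?r\<^sup>+" if "(x, y) \<in> r\<^sup>+" for y
    using that
  proof (induction rule: trancl_induct)
    case (base y)
    then show ?case using assms(2) by (auto intro!: r_into_trancl)
  next
    case (step y z)
    show ?case
    proof
      assume "z \<noteq> v"
      moreover have "y \<noteq> v" using step.hyps assms(2) by auto
      ultimately show "(x, z) \<in> ?r\<^sup>+"
        using step by (auto intro: trancl_into_trancl)
    qed
  qed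
  moreover have "x \<noteq> v" using tranclD[OF cyc] assms(2) by auto
  ultimately show False using cyc assms(1) by (auto simp: acyclic_def)
qed

lemma acyclic_if_no_crossing:
  assumes closed: "\<And>u v. (u, v) \<in> r \<Longrightarrow> u \<in> A \<longleftrightarrow> v \<in> A"
    and "acyclic (Restr r A)" and "acyclic (Restr r (- A))"
  shows "acyclic r"
proof (rule acyclicI, intro allI notI)
  fix x assume cyc: "(x, x) \<in> r\<^sup>+"
  have "(x \<in> A \<longrightarrow> y \<in> A \<and> (x, y) \<in> (Restr r A)\<^sup>+) \<and>
        (x \<notin> A \<longrightarrow> y \<notin> A \<and> (x, y) \<in> (Restr r (- A))\<^sup>+)" if "(x, y) \<in> r\<^sup>+" for y
    using that
  proof (induction rule: trancl_induct)
    case (base y)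
    then show ?case using closed by (auto intro!: r_into_trancl)
  next
    case (step y z)
    then show ?case using closed[of y z] by (auto intro: trancl_into_trancl)
  qed
  from this[OF cyc] show False using assms(2,3) by (auto simp: acyclic_def)
qed

section \<open>Acyclic colourings\<close>

text \<open>Digraphs are relations \<open>E\<close> together with a vertex set \<open>V\<close> to which \<open>E\<close> is implicitly restricted, so
  that passing to an induced subgraph only changes \<open>V\<close>.\<close>

definition monochromatic :: "'a rel \<Rightarrow> 'a set \<Rightarrow> ('a \<Rightarrow> 'c) \<Rightarrow> 'a rel" where
  "monochromatic E V c = {(u, v) \<in> E. u \<in> V \<and> v \<in> V \<and> c u = c v}"

text \<open>A directed cycle of monochromatic edges stays in one colour class, so a single acyclicity
  condition covers all classes.\<close>

definition acyclic_colouring :: "'a rel \<Rightarrow> 'a set \<Rightarrow> ('a \<Rightarrow> 'c) \<Rightarrow> bool" where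
  "acyclic_colouring E V c \<longleftrightarrow> acyclic (monochromatic E V c)"

definition colourable :: "'a rel \<Rightarrow> 'a set \<Rightarrow> nat \<Rightarrow> bool" where
  "colourable E V k \<longleftrightarrow> (\<exists>c. (\<forall>v\<in>V. c v < k) \<and> acyclic_colouring E V c)"

definition out_nbrs :: "'a rel \<Rightarrow> 'a set \<Rightarrow> 'a \<Rightarrow> 'a set" where
  "out_nbrs E V v = {u \<in> V. (v, u) \<in> E}"

definition in_nbrs :: "'a rel \<Rightarrow> 'a set \<Rightarrow> 'a \<Rightarrow> 'a set" where
  "in_nbrs E V v = {u \<in> V. (u, v) \<in> E}"

definition total_deg :: "'a rel \<Rightarrow> 'a set \<Rightarrow> 'a \<Rightarrow> nat" where
  "total_deg E V v = card (out_nbrs E V v) + card (in_nbrs E V v)"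

lemma out_nbrs_converse [simp]: "out_nbrs (E\<inverse>) V v = in_nbrs E V v"
  and in_nbrs_converse [simp]: "in_nbrs (E\<inverse>) V v = out_nbrs E V v"
  by (auto simp: out_nbrs_def in_nbrs_def)

lemma acyclic_colouring_converse [simp]:
  "acyclic_colouring (E\<inverse>) V c \<longleftrightarrow> acyclic_colouring E V c"
proof -
  have "monochromatic (E\<inverse>) V c = (monochromatic E V c)\<inverse>"
    by (auto simp: monochromatic_def)
  then show ?thesis by (simp add: acyclic_colouring_def)
qed

lemma acyclic_colouring_cong:
  assumes "\<And>u v. u \<in> V \<Longrightarrow> v \<in> V \<Longrightarrow> c u = c v \<longleftrightarrow> d u = d v"
  shows "acyclic_colouring E V c \<longleftrightarrow> acyclic_colouring E V d"
proof -
  have "monochromatic E V c = monochromatic E V d"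
    using assms by (auto simp: monochromatic_def)
  then show ?thesis by (simp add: acyclic_colouring_def)
qed

lemma acyclic_colouring_subset:
  "acyclic_colouring E V c \<Longrightarrow> W \<subseteq> V \<Longrightarrow> acyclic_colouring E W c"
  unfolding acyclic_colouring_def
  by (erule acyclic_subset) (auto simp: monochromatic_def)

lemma acyclic_colouring_extend_out:
  assumes "acyclic_colouring E (V - {v}) c" and "\<And>u. u \<in> out_nbrs E V v \<Longrightarrow> c u \<noteq> c v"
  shows "acyclic_colouring E V c"
  unfolding acyclic_colouring_def
proof (rule acyclic_if_sink)
  have "{(x, y) \<in> monochromatic E V c. x \<noteq> v \<and> y \<noteq> v} = monochromatic E (V - {v}) c"
    by (auto simp: monochromatic_def)
  then show "acyclic {(x, y) \<in> monochromatic E V c. x \<noteq> v \<and> y \<noteq> v}"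
    using assms(1) by (simp add: acyclic_colouring_def)
  show "v \<notin> Domain (monochromatic E V c)"
    using assms(2) by (force simp: monochromatic_def out_nbrs_def)
qed

lemma acyclic_colouring_extend_in:
  assumes "acyclic_colouring E (V - {v}) c" and "\<And>u. u \<in> in_nbrs E V v \<Longrightarrow> c u \<noteq> c v"
  shows "acyclic_colouring E V c"
  using acyclic_colouring_extend_out[of "E\<inverse>" V v c] assms by simp

text \<open>Fewer than \<open>k\<close> out-neighbours, or fewer than \<open>k\<close> in-neighbours, leave a colour that makes
  \<open>v\<close> a sink or a source of its class. Hence a vertex-minimal graph that is not \<open>k\<close>-colourable has
  all in-degrees and all out-degrees at least \<open>k\<close>.\<close>

lemma colourable_extend:
  assumes "finite V" and "(v, v) \<notin> E" and "colourable E (V - {v}) k"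
    and "card (out_nbrs E V v) < k \<or> card (in_nbrs E V v) < k"
  shows "colourable E V k"
proof -
  obtain c where c: "\<forall>u\<in>V - {v}. c u < k" "acyclic_colouring E (V - {v}) c"
    using assms(3) by (auto simp: colourable_def)
  have free: "\<exists>i<k. i \<notin> c ` N" if "card N < k" "finite N" for N
  proof (rule ccontr)
    assume "\<not> ?thesis"
    then have "{..<k} \<subseteq> c ` N" by auto
    then have "k \<le> card (c ` N)" using card_mono[of "c ` N" "{..<k}"] that by simp
    then show False using card_image_le[of N c] that by simp
  qed
  have ext: "acyclic_colouring E (V - {v}) (c(v := i))" for i
    using c(2) by (subst acyclic_colouring_cong[where d = c]) auto
  have fin: "finite (out_nbrs E V v)" "finite (in_nbrs E V v)"
    using assms(1) by (auto simp: out_nbrs_def in_nbrs_def)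
  have loop: "v \<notin> out_nbrs E V v" "v \<notin> in_nbrs E V v"
    using assms(2) by (auto simp: out_nbrs_def in_nbrs_def)
  have "\<exists>i<k. acyclic_colouring E V (c(v := i))"
  proof (cases "card (out_nbrs E V v) < k")
    case True
    with free fin obtain i where "i < k" "i \<notin> c ` out_nbrs E V v" by blast
    then show ?thesis using loop
      by (intro exI[of _ i] conjI acyclic_colouring_extend_out[OF ext]) auto
  next
    case False
    with assms(4) free fin obtain i where "i < k" "i \<notin> c ` in_nbrs E V v" by blast
    then show ?thesis using loop
      by (intro exI[of _ i] conjI acyclic_colouring_extend_in[OF ext]) auto
  qed
  then obtain i where "i < k" "acyclic_colouring E V (c(v := i))" by blast
  then show ?thesis
    unfolding colourable_def using c(1) by (intro exI[of _ "c(v := i)"]) auto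
qed

lemma colourable_union:
  assumes "colourable E A k" and "colourable E B l"
  shows "colourable E (A \<union> B) (k + l)"
proof -
  obtain c where c: "\<forall>v\<in>A. c v < k" "acyclic_colouring E A c"
    using assms(1) by (auto simp: colourable_def)
  obtain d where d: "\<forall>v\<in>B. d v < l" "acyclic_colouring E B d"
    using assms(2) by (auto simp: colourable_def)
  define e where "e v = (if v \<in> A then c v else k + d v)" for v
  have "acyclic (monochromatic E (A \<union> B) e)"
  proof (rule acyclic_if_no_crossing[where A = A])
    fix u v assume "(u, v) \<in> monochromatic E (A \<union> B) e"
    then show "u \<in> A \<longleftrightarrow> v \<in> A"
      using c(1) by (fastforce simp: monochromatic_def e_def split: if_splits)
  next
    show "acyclic (Restr (monochromatic E (A \<union> B) e) A)"
      using c(2) unfolding acyclic_colouring_def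
      by (rule acyclic_subset) (auto simp: monochromatic_def e_def)
    show "acyclic (Restr (monochromatic E (A \<union> B) e) (- A))"
      using d(2) unfolding acyclic_colouring_def
      by (rule acyclic_subset) (auto simp: monochromatic_def e_def)
  qed
  moreover have "\<forall>v\<in>A \<union> B. e v < k + l"
    using c(1) d(1) by (auto simp: e_def)
  ultimately show ?thesis by (auto simp: colourable_def acyclic_colouring_def)
qed

text \<open>Truth values as colours make ``the other colour'' a negation.\<close>

lemma colourable_2_iff:
  "colourable E V 2 \<longleftrightarrow> (\<exists>c :: 'a \<Rightarrow> bool. acyclic_colouring E V c)"
proof
  assume "colourable E V 2"
  then obtain c :: "'a \<Rightarrow> nat" where c: "\<forall>v\<in>V. c v < 2" "acyclic_colouring E V c"
    by (auto simp: colourable_def)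
  have "acyclic_colouring E V (\<lambda>v. c v = 0)"
    using c by (subst acyclic_colouring_cong[where d = c]) (metis less_2_cases, assumption)
  then show "\<exists>c :: 'a \<Rightarrow> bool. acyclic_colouring E V c" by blast
next
  assume "\<exists>c :: 'a \<Rightarrow> bool. acyclic_colouring E V c"
  then obtain c :: "'a \<Rightarrow> bool" where c: "acyclic_colouring E V c" by blast
  have "acyclic_colouring E V (\<lambda>v. of_bool (c v) :: nat)"
    using c by (subst acyclic_colouring_cong[where d = c]) auto
  then show "colourable E V 2"
    unfolding colourable_def by (intro exI[of _ "\<lambda>v. of_bool (c v)"]) auto
qed

section \<open>Two colours for total degree four\<close>

lemma distinct_walk_from_rtrancl:
  assumes "(a, d) \<in> (Restr r W)\<^sup>*" and "a \<in> W"
  obtains xs where "distinct xs" "set xs \<subseteq> W" "successively (\<lambda>x y. (x, y) \<in> r) xs"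
    "xs \<noteq> []" "hd xs = a" "last xs = d"
proof -
  have "\<exists>xs. distinct xs \<and> set xs \<subseteq> W \<and> successively (\<lambda>x y. (x, y) \<in> r) xs
      \<and> xs \<noteq> [] \<and> hd xs = a \<and> last xs = d"
    using assms(1)
  proof (induction rule: rtrancl_induct)
    case base
    show ?case using assms(2) by (intro exI[of _ "[a]"]) auto
  next
    case (step y z)
    then obtain xs where xs: "distinct xs" "set xs \<subseteq> W" "successively (\<lambda>x y. (x, y) \<in> r) xs"
      "xs \<noteq> []" "hd xs = a" "last xs = y" by blast
    show ?case
    proof (cases "z \<in> set xs")
      case True
      then obtain ys zs where "xs = ys @ z # zs" by (meson split_list)
      then have "xs = (ys @ [z]) @ zs" by simp
      with xs show ?thesis
        by (intro exI[of _ "ys @ [z]"]) (auto simp: successively_append_iff hd_append)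
    next
      case False
      with xs step.hyps show ?thesis
        by (intro exI[of _ "xs @ [z]"]) (auto simp: successively_append_iff)
    qed
  qed
  with that show thesis by blast
qed

text \<open>The hole, an uncoloured vertex, travels along a list of vertices: each vertex that it enters hands
  its colour back to the vertex that it leaves. The value at the final position of the hole is left over
  from before and has no meaning.\<close>

fun move_hole :: "('a \<Rightarrow> 'c) \<Rightarrow> 'a \<Rightarrow> 'a list \<Rightarrow> ('a \<Rightarrow> 'c)" where
  "move_hole c h [] = c"
| "move_hole c h (x # xs) = move_hole (c(h := c x)) x xs"

lemma move_hole_append:
  "move_hole c h (xs @ ys) = move_hole (move_hole c h xs) (last (h # xs)) ys"
  by (induction xs arbitrary: c h) auto

lemma move_hole_other: "x \<notin> set (h # xs) \<Longrightarrow> move_hole c h xs x = c x"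
  by (induction xs arbitrary: c h) auto

lemma move_hole_step:
  assumes "x \<notin> set (y # ys)" and "y \<notin> set (h # xs)"
  shows "move_hole c h (xs @ x # y # ys) x = c y"
proof -
  let ?c = "move_hole c h (xs @ [x])"
  have "move_hole c h (xs @ x # y # ys) x = move_hole ?c x (y # ys) x"
    using move_hole_append[of c h "xs @ [x]" "y # ys"] by simp
  also have "\<dots> = ?c y"
    using assms(1) by (simp add: move_hole_other)
  also have "\<dots> = c y"
    using assms by (intro move_hole_other) auto
  finally show ?thesis .
qed

text \<open>The degrees of a vertex-minimal oriented graph of total degree at most 4 without an acyclic
  2-colouring.\<close>

locale uncolourable_2_2_regular =
  fixes E :: "'a rel" and V :: "'a set"
  assumes asym: "(u, v) \<in> E \<Longrightarrow> (v, u) \<notin> E"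
    and out_2: "v \<in> V \<Longrightarrow> card (out_nbrs E V v) = 2"
    and in_2: "v \<in> V \<Longrightarrow> card (in_nbrs E V v) = 2"
    and uncolourable: "\<not> acyclic_colouring E V (c :: 'a \<Rightarrow> bool)"
begin

abbreviation adj :: "'a rel" where "adj \<equiv> E \<union> E\<inverse>"

definition hole_colouring :: "('a \<Rightarrow> bool) \<Rightarrow> 'a \<Rightarrow> bool" where
  "hole_colouring c h \<longleftrightarrow> h \<in> V \<and> acyclic_colouring E (V - {h}) c"

text \<open>Reversing all edges exchanges the roles of in- and out-neighbours, so each fact proved for one of
  them holds for the other.\<close>

lemma converse: "uncolourable_2_2_regular (E\<inverse>) V"
  by unfold_locales (use asym out_2 in_2 uncolourable in auto)

lemma hole_colouring_converse:
  "uncolourable_2_2_regular.hole_colouring (E\<inverse>) V c h \<longleftrightarrow> hole_colouring c h"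
  by (simp add: hole_colouring_def uncolourable_2_2_regular.hole_colouring_def[OF converse])

lemma nbrs_irrefl: "h \<notin> in_nbrs E V h" "h \<notin> out_nbrs E V h"
  using asym[of h h] by (auto simp: in_nbrs_def out_nbrs_def)

text \<open>If both in-neighbours had the same colour, the hole could take the other one: it would be a source
  of its class, and all of \<open>V\<close> would be coloured.\<close>

lemma in_nbrs_differ:
  assumes "hole_colouring c h" and "a \<in> in_nbrs E V h" "b \<in> in_nbrs E V h" "a \<noteq> b"
  shows "c a \<noteq> c b"
proof
  assume same: "c a = c b"
  have h: "h \<in> V" "acyclic_colouring E (V - {h}) c"
    using assms(1) by (auto simp: hole_colouring_def)
  have "finite (in_nbrs E V h)" using in_2[OF h(1)] by (metis card.infinite zero_neq_numeral)
  then have nbrs: "in_nbrs E V h = {a, b}"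
    using assms(2-4) in_2[OF h(1)] by (intro card_subset_eq[symmetric]) auto
  have "acyclic_colouring E V (c(h := \<not> c a))"
  proof (rule acyclic_colouring_extend_in[where v = h])
    show "acyclic_colouring E (V - {h}) (c(h := \<not> c a))"
      using h(2) by (subst acyclic_colouring_cong[where d = c]) auto
    show "(c(h := \<not> c a)) u \<noteq> (c(h := \<not> c a)) h" if "u \<in> in_nbrs E V h" for u
      using that nbrs nbrs_irrefl[of h] same by auto
  qed
  then show False using uncolourable by blast
qed

lemma out_nbrs_differ:
  assumes "hole_colouring c h" and "a \<in> out_nbrs E V h" "b \<in> out_nbrs E V h" "a \<noteq> b"
  shows "c a \<noteq> c b"
  using uncolourable_2_2_regular.in_nbrs_differ[OF converse, of c h a b] assms
  by (simp add: hole_colouring_converse)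

text \<open>If \<open>u\<close> is an in-neighbour of \<open>h\<close>, it is the only one of its colour, so once \<open>u\<close> is uncoloured \<open>h\<close> can
  take that colour and be a source of its class. An out-neighbour makes \<open>h\<close> a sink instead.\<close>

lemma shift_hole:
  assumes "hole_colouring c h" and "u \<in> V" and "(h, u) \<in> adj"
  shows "hole_colouring (c(h := c u)) u"
proof -
  let ?c = "c(h := c u)"
  have h: "h \<in> V" "acyclic_colouring E (V - {h}) c"
    using assms(1) by (auto simp: hole_colouring_def)
  have base: "acyclic_colouring E (V - {u} - {h}) ?c"
  proof -
    have "acyclic_colouring E (V - {u} - {h}) c"
      using h(2) by (rule acyclic_colouring_subset) auto
    then show ?thesis by (subst acyclic_colouring_cong[where d = c]) auto
  qed
  have "acyclic_colouring E (V - {u}) ?c"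
  proof (cases "(u, h) \<in> E")
    case True
    then have "u \<in> in_nbrs E V h" using assms(2) by (simp add: in_nbrs_def)
    then have "?c w \<noteq> ?c h" if "w \<in> in_nbrs E (V - {u}) h" for w
      using that in_nbrs_differ[OF assms(1), of w u] nbrs_irrefl[of h] by (auto simp: in_nbrs_def)
    then show ?thesis by (rule acyclic_colouring_extend_in[OF base])
  next
    case False
    then have "u \<in> out_nbrs E V h" using assms(2,3) by (simp add: out_nbrs_def)
    then have "?c w \<noteq> ?c h" if "w \<in> out_nbrs E (V - {u}) h" for w
      using that out_nbrs_differ[OF assms(1), of w u] nbrs_irrefl[of h] by (auto simp: out_nbrs_def)
    then show ?thesis by (rule acyclic_colouring_extend_out[OF base])
  qed
  then show ?thesis using assms(2) by (simp add: hole_colouring_def)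
qed

lemma move_hole_colouring:
  assumes "hole_colouring c h" and "set xs \<subseteq> V" and "successively (\<lambda>x y. (x, y) \<in> adj) (h # xs)"
  shows "hole_colouring (move_hole c h xs) (last (h # xs))"
  using assms
proof (induction xs arbitrary: c h)
  case (Cons x xs)
  have "hole_colouring (c(h := c x)) x"
    using Cons.prems by (intro shift_hole) auto
  then show ?case
    using Cons.IH[of "c(h := c x)" x] Cons.prems by (simp add: successively_Cons del: fun_upd_apply)
qed simp

text \<open>One turn of the hole around the cycle \<open>h, vs\<close> shifts the colours on \<open>vs\<close> by one place and
  leaves the colour of \<open>b\<close> alone. Before and after the turn the in-neighbours \<open>vs ! 0\<close> and \<open>b\<close> have
  different colours, and there are just two colours, so the turn does not change the colour of \<open>vs ! 0\<close>.
  Repeated turns bring every colour on the cycle to that place.\<close>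

lemma cycle_through_hole_monochromatic:
  assumes "hole_colouring c h" and "distinct vs" "h \<notin> set vs" "set vs \<subseteq> V"
    and walk: "successively (\<lambda>x y. (x, y) \<in> adj) (h # vs @ [h])"
    and "vs ! 0 \<in> in_nbrs E V h" "b \<in> in_nbrs E V h" "b \<notin> set vs"
    and "i < length vs"
  shows "c (vs ! i) = c (vs ! 0)"
  using assms(1,9)
proof (induction i arbitrary: c)
  case (Suc i)
  define c' where "c' = move_hole c h (vs @ [h])"
  have "h \<in> V" using Suc.prems(1) by (simp add: hole_colouring_def)
  then have hole': "hole_colouring c' h"
    using move_hole_colouring[OF Suc.prems(1) _ walk] assms(4) by (simp add: c'_def)
  have rot: "c' (vs ! j) = c (vs ! Suc j)" if "Suc j < length vs" for j
  proof -
    have split: "vs = take j vs @ vs ! j # vs ! Suc j # drop (Suc (Suc j)) vs"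
      using that by (metis Cons_nth_drop_Suc Suc_lessD id_take_nth_drop)
    have "distinct (take j vs @ vs ! j # vs ! Suc j # drop (Suc (Suc j)) vs)"
      using assms(2) by (subst split[symmetric])
    moreover have "vs ! j \<noteq> h" "vs ! Suc j \<noteq> h"
      using assms(3) that by (metis Suc_lessD nth_mem)+
    ultimately have "move_hole c h (take j vs @ vs ! j # vs ! Suc j # (drop (Suc (Suc j)) vs @ [h])) (vs ! j)
        = c (vs ! Suc j)"
      by (intro move_hole_step) auto
    moreover have "vs @ [h] = take j vs @ vs ! j # vs ! Suc j # (drop (Suc (Suc j)) vs @ [h])"
      by (subst (1) split) (simp only: append.assoc append_Cons)
    ultimately show ?thesis by (simp only: c'_def)
  qed
  have ne: "vs ! 0 \<noteq> b" using assms(8) Suc.prems(2) by (metis nth_mem Suc_lessD less_trans zero_less_Suc)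
  have "c' b = c b"
    unfolding c'_def using assms(7,8) nbrs_irrefl(1)[of h] by (intro move_hole_other) auto
  then have "c' (vs ! 0) = c (vs ! 0)"
    using in_nbrs_differ[OF hole' assms(6,7) ne] in_nbrs_differ[OF Suc.prems(1) assms(6,7) ne] by auto
  moreover have "c' (vs ! i) = c' (vs ! 0)"
    using Suc.IH[OF hole'] Suc.prems(2) by simp
  ultimately show ?case using rot[of i] Suc.prems(2) by simp
qed simp

text \<open>A path from \<open>a\<close> to \<open>d\<close> would close up through \<open>h\<close> to a cycle that has two colours but
  avoids \<open>b\<close>.\<close>

lemma in_out_separated:
  assumes "hole_colouring c h" and "a \<in> in_nbrs E V h" "b \<in> in_nbrs E V h" "a \<noteq> b"
    and "d \<in> out_nbrs E V h" "c a \<noteq> c d"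
  shows "(a, d) \<notin> (Restr adj (V - {h, b}))\<^sup>*"
proof
  assume "(a, d) \<in> (Restr adj (V - {h, b}))\<^sup>*"
  moreover have "a \<in> V - {h, b}"
    using assms(2,4) nbrs_irrefl[of h] by (auto simp: in_nbrs_def)
  ultimately obtain vs where vs: "distinct vs" "set vs \<subseteq> V - {h, b}"
      "successively (\<lambda>x y. (x, y) \<in> adj) vs" "vs \<noteq> []" "hd vs = a" "last vs = d"
    by (rule distinct_walk_from_rtrancl)
  have "successively (\<lambda>x y. (x, y) \<in> adj) (h # vs @ [h])"
    using vs(3-6) assms(2,5)
    by (auto simp: successively_append_iff successively_Cons in_nbrs_def out_nbrs_def hd_append)
  moreover have "vs ! 0 = a" "vs ! (length vs - 1) = d"
    using vs(4-6) by (simp_all add: hd_conv_nth last_conv_nth)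
  ultimately have "c d = c a"
    using cycle_through_hole_monochromatic[of c h vs b "length vs - 1"] vs assms(1-3) by auto
  then show False using assms(6) by simp
qed

text \<open>Giving \<open>h\<close> the colour of \<open>a\<close> must create a monochromatic directed cycle. It leaves \<open>h\<close> to \<open>x\<close> and
  returns from \<open>a\<close>, because these are the only neighbours of \<open>h\<close> of that colour on the respective
  sides, and it avoids \<open>b\<close>, which has the other colour.\<close>

lemma same_colour_nbrs_connected:
  assumes "hole_colouring c h" and "a \<in> in_nbrs E V h" "b \<in> in_nbrs E V h" "a \<noteq> b"
    and "x \<in> out_nbrs E V h" "c x = c a"
  shows "(x, a) \<in> (Restr adj (V - {h, b}))\<^sup>*"
proof -
  \<comment> \<open>Without the edge from \<open>a\<close> into \<open>h\<close> the recoloured graph is acyclic, so the cycle is a path in \<open>r\<close>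
    closed by that edge.\<close>
  define r where "r = {(u, v) \<in> monochromatic E V (c(h := c a)). v \<noteq> h}"
  have h: "h \<in> V" "acyclic_colouring E (V - {h}) c"
    using assms(1) by (auto simp: hole_colouring_def)
  have ab: "c a \<noteq> c b" using in_nbrs_differ assms by blast
  have only_a: "u = a" if "(u, h) \<in> monochromatic E V (c(h := c a))" for u
    using that in_nbrs_differ[OF assms(1), of u a] assms(2) asym[of h h]
    by (auto simp: monochromatic_def in_nbrs_def split: if_splits)
  have only_x: "u = x" if "(h, u) \<in> r" for u
    using that out_nbrs_differ[OF assms(1), of u x] assms(5,6) asym[of h h]
    by (auto simp: r_def monochromatic_def out_nbrs_def split: if_splits)
  have "acyclic r"
  proof -
    have "acyclic (r\<inverse>)"
    proof (rule acyclic_if_sink[where v = h])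
      have "acyclic ((monochromatic E (V - {h}) c)\<inverse>)"
        using h(2) by (simp add: acyclic_colouring_def)
      then show "acyclic {(u, v) \<in> r\<inverse>. u \<noteq> h \<and> v \<noteq> h}"
        by (rule acyclic_subset) (auto simp: r_def monochromatic_def)
      show "h \<notin> Domain (r\<inverse>)" by (auto simp: r_def)
    qed
    then show ?thesis by simp
  qed
  moreover have "monochromatic E V (c(h := c a)) \<subseteq> insert (a, h) r"
    using only_a by (auto simp: r_def)
  then have "\<not> acyclic (insert (a, h) r)"
    using uncolourable[of "c(h := c a)"] acyclic_subset by (auto simp: acyclic_colouring_def)
  ultimately have "(h, a) \<in> r\<^sup>*" by simp
  moreover have "h \<noteq> a" using assms(2) nbrs_irrefl by blast
  ultimately obtain y where "(h, y) \<in> r" "(y, a) \<in> r\<^sup>*" by (metis converse_rtranclE)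
  then have "(x, a) \<in> r\<^sup>*" using only_x by blast
  have "(x, y) \<in> (Restr adj (V - {h, b}))\<^sup>* \<and> y \<noteq> h \<and> c y = c a" if "(x, y) \<in> r\<^sup>*" for y
    using that
  proof (induction rule: rtrancl_induct)
    case base
    then show ?case using assms(5,6) nbrs_irrefl[of h] by auto
  next
    case (step y z)
    then have "y \<noteq> h" "z \<noteq> h" "c y = c a" "(y, z) \<in> E" "y \<in> V" "z \<in> V" "c z = c a"
      by (auto simp: r_def monochromatic_def)
    then have "(y, z) \<in> Restr adj (V - {h, b})" using ab by auto
    then show ?case using step.IH \<open>z \<noteq> h\<close> \<open>c z = c a\<close> by (meson rtrancl.rtrancl_into_rtrancl)
  qed
  then show ?thesis using \<open>(x, a) \<in> r\<^sup>*\<close> by blast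
qed

text \<open>Let \<open>a, x\<close> be the in- and the out-neighbour of \<open>h\<close> of one colour and \<open>b, d\<close> those of the other. The
  vertices \<open>a\<close> and \<open>d\<close> are connected in the graph without \<open>h\<close>, as otherwise exchanging the colours on the
  component of \<open>a\<close>, which contains \<open>x\<close>, would give \<open>x\<close> and \<open>d\<close> the same colour. By
  \<open>in_out_separated\<close> every connection from \<open>a\<close> to \<open>d\<close> passes through \<open>b\<close>. So the component \<open>R\<close> of \<open>a\<close> after
  removal of \<open>b\<close> contains \<open>x\<close>, has an edge to \<open>b\<close>, and does not contain \<open>d\<close>. But then \<open>x\<close> and \<open>b\<close> are
  connected without \<open>h\<close> and \<open>d\<close>, which contradicts \<open>in_out_separated\<close> for the reversed graph.\<close>

lemma no_hole_colouring: "\<not> hole_colouring c h"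
proof
  assume hole: "hole_colouring c h"
  then have h: "h \<in> V" "acyclic_colouring E (V - {h}) c"
    by (auto simp: hole_colouring_def)
  obtain a b where ab: "in_nbrs E V h = {a, b}" "a \<noteq> b"
    using in_2[OF h(1)] by (auto simp: card_2_iff)
  have c_ab: "c a \<noteq> c b" using in_nbrs_differ[OF hole] ab by auto
  obtain x d where xd: "out_nbrs E V h = {x, d}" "x \<noteq> d" "c x = c a"
  proof -
    obtain p q where pq: "out_nbrs E V h = {p, q}" "p \<noteq> q"
      using out_2[OF h(1)] by (auto simp: card_2_iff)
    then have "c p \<noteq> c q" using out_nbrs_differ[OF hole] by auto
    then show thesis using that[of p q] that[of q p] pq by (cases "c p = c a") auto
  qed
  have c_xd: "c x \<noteq> c d" using out_nbrs_differ[OF hole] xd by auto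
  have "b \<noteq> d"
    using ab xd asym[of b h] by (auto simp: in_nbrs_def out_nbrs_def set_eq_iff)
  have "a \<in> V" "a \<noteq> h" "d \<in> V" "d \<noteq> h" "b \<in> V" "b \<noteq> h"
    using ab xd nbrs_irrefl[of h] by (auto simp: in_nbrs_def out_nbrs_def)
  have U_mono: "(Restr adj A)\<^sup>* \<subseteq> (Restr adj B)\<^sup>*" if "A \<subseteq> B" for A B
    using that by (intro rtrancl_mono) auto
  have U_sym: "sym ((Restr adj A)\<^sup>*)" for A
    by (intro sym_rtrancl) (auto simp: sym_def)
  have xa: "(x, a) \<in> (Restr adj (V - {h, b}))\<^sup>*"
    using same_colour_nbrs_connected[OF hole, of a b x] ab xd by auto
  have sep_ad: "(a, d) \<notin> (Restr adj (V - {h, b}))\<^sup>*"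
    using in_out_separated[OF hole, of a b d] ab xd c_xd by auto
  have sep_xb: "(x, b) \<notin> (Restr adj (V - {h, d}))\<^sup>*"
    using uncolourable_2_2_regular.in_out_separated[OF converse, of c h x d b] hole ab xd c_ab
    by (auto simp: hole_colouring_converse Un_commute)

  have ad: "(a, d) \<in> (Restr adj (V - {h}))\<^sup>*"
  proof (rule ccontr)
    assume sep: "(a, d) \<notin> (Restr adj (V - {h}))\<^sup>*"
    \<comment> \<open>The component of \<open>a\<close>, on which the colours are exchanged.\<close>
    define K where "K = (Restr adj (V - {h}))\<^sup>* `` {a}"
    define c' where "c' v = (c v \<noteq> (v \<in> K))" for v
    have K_closed: "u \<in> K \<longleftrightarrow> v \<in> K" if "(u, v) \<in> E" "u \<in> V - {h}" "v \<in> V - {h}" for u v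
    proof -
      have "(u, v) \<in> Restr adj (V - {h})" "(v, u) \<in> Restr adj (V - {h})" using that by auto
      then show ?thesis unfolding K_def by (auto intro: rtrancl_into_rtrancl)
    qed
    have "acyclic (monochromatic E (V - {h}) c')"
    proof -
      have "monochromatic E (V - {h}) c' \<subseteq> monochromatic E (V - {h}) c"
        using K_closed by (auto simp: monochromatic_def c'_def)
      then show ?thesis using h(2) acyclic_subset by (auto simp: acyclic_colouring_def)
    qed
    then have "hole_colouring c' h" using h(1) by (simp add: hole_colouring_def acyclic_colouring_def)
    then have "c' x \<noteq> c' d" using out_nbrs_differ[of c' h x d] xd by auto
    moreover have "d \<notin> K" using sep by (simp add: K_def)
    moreover have "x \<in> K"
      using symD[OF U_sym xa] U_mono[of "V - {h, b}" "V - {h}"] by (auto simp: K_def)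
    ultimately show False using c_xd by (simp add: c'_def)
  qed

  define R where "R = (Restr adj (V - {h, b}))\<^sup>* `` {a}"
  have "d \<notin> R" using sep_ad by (simp add: R_def)
  have R_sub: "R \<subseteq> V - {h, b}"
  proof
    fix y assume "y \<in> R"
    then have "(a, y) \<in> (Restr adj (V - {h, b}))\<^sup>*" by (simp add: R_def)
    then show "y \<in> V - {h, b}"
      by (cases rule: rtranclE) (use \<open>a \<in> V\<close> \<open>a \<noteq> h\<close> \<open>a \<noteq> b\<close> in auto)
  qed
  have "\<exists>r\<in>R. (r, b) \<in> adj"
  proof (rule ccontr)
    assume no_exit: "\<not> ?thesis"
    have "y \<in> R" if "(a, y) \<in> (Restr adj (V - {h}))\<^sup>*" for y
      using that
    proof (induction rule: rtrancl_induct)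
      case base
      show ?case by (simp add: R_def)
    next
      case (step y z)
      then have "(y, z) \<in> Restr adj (V - {h, b})" using no_exit R_sub by auto
      then show ?case using step.IH unfolding R_def by (auto intro: rtrancl_into_rtrancl)
    qed
    with ad \<open>d \<notin> R\<close> show False by blast
  qed
  then obtain r where r: "r \<in> R" "(r, b) \<in> adj" by blast
  have x_to: "(x, y) \<in> (Restr adj (V - {h, d}))\<^sup>* \<and> y \<in> R" if "(x, y) \<in> (Restr adj (V - {h, b}))\<^sup>*" for y
    using that
  proof (induction rule: rtrancl_induct)
    case base
    show ?case using symD[OF U_sym xa] by (simp add: R_def)
  next
    case (step y z)
    then have "z \<in> R" unfolding R_def by (auto intro: rtrancl_into_rtrancl)
    then have "(y, z) \<in> Restr adj (V - {h, d})"
      using step \<open>d \<notin> R\<close> by auto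
    then show ?case using step.IH \<open>z \<in> R\<close> by (auto intro: rtrancl_into_rtrancl)
  qed
  have "(x, r) \<in> (Restr adj (V - {h, b}))\<^sup>*"
    using xa r(1) by (auto simp: R_def)
  then have "(x, r) \<in> (Restr adj (V - {h, d}))\<^sup>*" using x_to by blast
  moreover have "(r, b) \<in> Restr adj (V - {h, d})"
    using r R_sub \<open>d \<notin> R\<close> \<open>b \<in> V\<close> \<open>b \<noteq> h\<close> \<open>b \<noteq> d\<close> by auto
  ultimately have "(x, b) \<in> (Restr adj (V - {h, d}))\<^sup>*" by (rule rtrancl_into_rtrancl)
  with sep_xb show False by blast
qed

end

lemma finite_nbrs [simp]:
  assumes "finite V"
  shows "finite (out_nbrs E V v)" "finite (in_nbrs E V v)"
  using assms by (auto simp: out_nbrs_def in_nbrs_def)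

lemma nbrs_card_mono:
  assumes "finite V" and "W \<subseteq> V"
  shows "card (out_nbrs E W v) \<le> card (out_nbrs E V v)" "card (in_nbrs E W v) \<le> card (in_nbrs E V v)"
  using assms by (auto intro!: card_mono simp: out_nbrs_def in_nbrs_def)

text \<open>In a smallest counterexample \<open>colourable_extend\<close> excludes degrees below 2, which leaves exactly 2 on
  both sides of each vertex; deleting any vertex then gives a colouring with a hole.\<close>

lemma colourable_2_if_total_deg_le_4:
  assumes "finite V" and asym: "\<And>u v. (u, v) \<in> E \<Longrightarrow> (v, u) \<notin> E"
    and "\<And>v. v \<in> V \<Longrightarrow> total_deg E V v \<le> 4"
  shows "colourable E V 2"
  using assms(1,3)
proof (induction "card V" arbitrary: V rule: less_induct)
  case less
  have sub: "colourable E (V - {v}) 2" if "v \<in> V" for v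
  proof (rule less.hyps)
    show "card (V - {v}) < card V" using less.prems(1) that by (metis card_Diff1_less)
    show "total_deg E (V - {v}) u \<le> 4" if "u \<in> V - {v}" for u
    proof -
      have "total_deg E (V - {v}) u \<le> total_deg E V u"
        unfolding total_deg_def by (intro add_mono nbrs_card_mono less.prems) auto
      then show ?thesis using less.prems(2)[of u] that by simp
    qed
  qed (use less.prems in auto)
  show ?case
  proof (cases "\<exists>v\<in>V. card (out_nbrs E V v) < 2 \<or> card (in_nbrs E V v) < 2")
    case True
    then obtain v where "v \<in> V" "card (out_nbrs E V v) < 2 \<or> card (in_nbrs E V v) < 2" by blast
    then show ?thesis
      using colourable_extend[OF less.prems(1) _ sub] asym[of v v] by blast
  next
    case False
    have deg: "card (out_nbrs E V v) = 2" "card (in_nbrs E V v) = 2" if "v \<in> V" for v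
      using less.prems(2)[OF that] False that by (force simp: total_deg_def)+
    show ?thesis
    proof (rule ccontr)
      assume "\<not> colourable E V 2"
      then interpret uncolourable_2_2_regular E V
        by unfold_locales (use asym deg in \<open>auto simp: colourable_2_iff\<close>)
      have "V \<noteq> {}" using \<open>\<not> colourable E V 2\<close> by (auto simp: colourable_def acyclic_colouring_def monochromatic_def acyclic_def)
      then obtain h where h: "h \<in> V" by blast
      then obtain c :: "'a \<Rightarrow> bool" where "acyclic_colouring E (V - {h}) c"
        using sub by (auto simp: colourable_2_iff)
      then show False using no_hole_colouring[of c h] h by (simp add: hole_colouring_def)
    qed
  qed
qed

section \<open>Splitting off parts of small degree\<close>

lemma card_edges_insert:
  assumes "finite A" and "v \<notin> A" and "(v, v) \<notin> E"
  shows "card (Restr E (insert v A)) = card (Restr E A) + total_deg E A v"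
proof -
  have "Restr E (insert v A) = Restr E A \<union> (Pair v ` out_nbrs E A v \<union> (\<lambda>u. (u, v)) ` in_nbrs E A v)"
    using assms(3) by (auto simp: out_nbrs_def in_nbrs_def)
  also have "card \<dots> = card (Restr E A) + card (Pair v ` out_nbrs E A v \<union> (\<lambda>u. (u, v)) ` in_nbrs E A v)"
    using assms by (intro card_Un_disjoint) (auto simp: out_nbrs_def in_nbrs_def)
  also have "card (Pair v ` out_nbrs E A v \<union> (\<lambda>u. (u, v)) ` in_nbrs E A v)
      = card (Pair v ` out_nbrs E A v) + card ((\<lambda>u. (u, v)) ` in_nbrs E A v)"
    using assms by (intro card_Un_disjoint) (auto simp: out_nbrs_def in_nbrs_def)
  also have "\<dots> = total_deg E A v"
    by (simp add: total_deg_def card_image inj_on_def)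
  finally show ?thesis .
qed

lemma total_deg_Un:
  assumes "finite A" "finite B" "A \<inter> B = {}"
  shows "total_deg E (A \<union> B) v = total_deg E A v + total_deg E B v"
proof -
  have "out_nbrs E (A \<union> B) v = out_nbrs E A v \<union> out_nbrs E B v"
    "in_nbrs E (A \<union> B) v = in_nbrs E A v \<union> in_nbrs E B v"
    by (auto simp: out_nbrs_def in_nbrs_def)
  moreover have "card (out_nbrs E A v \<union> out_nbrs E B v) = card (out_nbrs E A v) + card (out_nbrs E B v)"
    "card (in_nbrs E A v \<union> in_nbrs E B v) = card (in_nbrs E A v) + card (in_nbrs E B v)"
    using assms by (intro card_Un_disjoint; auto simp: out_nbrs_def in_nbrs_def)+
  ultimately show ?thesis by (simp add: total_deg_def)
qed

lemma total_deg_insert_self: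
  assumes "(v, v) \<notin> E"
  shows "total_deg E (insert v A) v = total_deg E A v"
proof -
  have "out_nbrs E (insert v A) v = out_nbrs E A v" "in_nbrs E (insert v A) v = in_nbrs E A v"
    using assms by (auto simp: out_nbrs_def in_nbrs_def)
  then show ?thesis by (simp add: total_deg_def)
qed

text \<open>Among all bipartitions \<open>(A, B)\<close> take one that minimizes the number of edges inside the parts plus
  \<open>t |A| + s |B|\<close>. Moving a vertex of \<open>A\<close> with more than \<open>s\<close> neighbours there (hence at most \<open>t\<close> in
  \<open>B\<close>) to \<open>B\<close> changes this quantity by at most \<open>(t - (s + 1)) + (s - t) = -1\<close>; moves from \<open>B\<close> to \<open>A\<close>
  are symmetric.\<close>

lemma degree_partition:
  assumes "finite V" and loopfree: "\<And>v. (v, v) \<notin> E"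
    and deg: "\<And>v. v \<in> V \<Longrightarrow> total_deg E V v \<le> s + t + 1"
  obtains A B where "A \<union> B = V" "A \<inter> B = {}"
    "\<And>v. v \<in> A \<Longrightarrow> total_deg E A v \<le> s" "\<And>v. v \<in> B \<Longrightarrow> total_deg E B v \<le> t"
proof -
  define \<Phi> where "\<Phi> = (\<lambda>(A, B). card (Restr E A) + card (Restr E B) + t * card A + s * card B)"
  define split where "split = (\<lambda>(A, B). A \<union> B = V \<and> A \<inter> B = {})"
  have "split (V, {})" by (simp add: split_def)
  then obtain AB where AB: "split AB" "\<And>p. split p \<Longrightarrow> \<Phi> AB \<le> \<Phi> p"
    using ex_has_least_nat[of split "(V, {})" \<Phi>] by blast
  obtain A B where AB_eq: "AB = (A, B)" by fastforce
  have part: "A \<union> B = V" "A \<inter> B = {}" using AB(1) by (auto simp: split_def AB_eq)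
  have fin: "finite A" "finite B" using part(1) assms(1) by (auto intro: finite_subset)
  have sum: "total_deg E A v + total_deg E B v \<le> s + t + 1" if "v \<in> V" for v
    using deg[OF that] total_deg_Un[OF fin part(2)] part(1) by metis
  have "total_deg E A v \<le> s" if v: "v \<in> A" for v
  proof (rule ccontr)
    assume big: "\<not> ?thesis"
    define A' where "A' = A - {v}"
    have A': "A = insert v A'" "v \<notin> A'" "finite A'" using v fin by (auto simp: A'_def)
    have "v \<notin> B" using v part by auto
    have "split (A', insert v B)" using v part by (auto simp: split_def A'_def)
    from AB(2)[OF this] have "\<Phi> (A, B) \<le> \<Phi> (A', insert v B)" by (simp add: AB_eq)
    moreover have "card (Restr E A) = card (Restr E A') + total_deg E A' v"
      using card_edges_insert[OF A'(3,2) loopfree] A'(1) by simp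
    moreover have "card (Restr E (insert v B)) = card (Restr E B) + total_deg E B v"
      by (rule card_edges_insert[OF fin(2) \<open>v \<notin> B\<close> loopfree])
    moreover have "t * card A = t * card A' + t" "s * card (insert v B) = s * card B + s"
      using A' fin(2) \<open>v \<notin> B\<close> by simp_all
    ultimately have "total_deg E A' v + t \<le> total_deg E B v + s"
      unfolding \<Phi>_def prod.case by linarith
    moreover have "total_deg E A' v = total_deg E A v"
      using A' total_deg_insert_self[OF loopfree] by metis
    ultimately show False using big sum[of v] v part by auto
  qed
  moreover have "total_deg E B v \<le> t" if v: "v \<in> B" for v
  proof (rule ccontr)
    assume big: "\<not> ?thesis"
    define B' where "B' = B - {v}"
    have B': "B = insert v B'" "v \<notin> B'" "finite B'" using v fin by (auto simp: B'_def)
    have "v \<notin> A" using v part by auto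
    have "split (insert v A, B')" using v part by (auto simp: split_def B'_def)
    from AB(2)[OF this] have "\<Phi> (A, B) \<le> \<Phi> (insert v A, B')" by (simp add: AB_eq)
    moreover have "card (Restr E B) = card (Restr E B') + total_deg E B' v"
      using card_edges_insert[OF B'(3,2) loopfree] B'(1) by simp
    moreover have "card (Restr E (insert v A)) = card (Restr E A) + total_deg E A v"
      by (rule card_edges_insert[OF fin(1) \<open>v \<notin> A\<close> loopfree])
    moreover have "s * card B = s * card B' + s" "t * card (insert v A) = t * card A + t"
      using B' fin(1) \<open>v \<notin> A\<close> by simp_all
    ultimately have "total_deg E B' v + s \<le> total_deg E A v + t"
      unfolding \<Phi>_def prod.case by linarith
    moreover have "total_deg E B' v = total_deg E B v"
      using B' total_deg_insert_self[OF loopfree] by metis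
    ultimately show False using big sum[of v] v part by auto
  qed
  ultimately show thesis using that part by blast
qed

lemma colourable_1_if_total_deg_le_1:
  assumes "finite V" and asym: "\<And>u v. (u, v) \<in> E \<Longrightarrow> (v, u) \<notin> E"
    and "\<And>v. v \<in> V \<Longrightarrow> total_deg E V v \<le> 1"
  shows "colourable E V 1"
  using assms(1,3)
proof (induction rule: finite_induct)
  case empty
  show ?case by (auto simp: colourable_def acyclic_colouring_def monochromatic_def acyclic_def)
next
  case (insert v V)
  have le: "total_deg E V u \<le> total_deg E (insert v V) u" for u
    unfolding total_deg_def using insert.hyps by (intro add_mono nbrs_card_mono) auto
  have "colourable E V 1"
    using insert.prems le by (intro insert.IH) (meson insertCI order_trans)
  then have "colourable E (insert v V - {v}) 1"
    using insert.hyps by simp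
  moreover have "card (out_nbrs E (insert v V) v) < 1 \<or> card (in_nbrs E (insert v V) v) < 1"
    using insert.prems[of v] by (simp add: total_deg_def) linarith
  moreover have "(v, v) \<notin> E" using asym[of v v] by blast
  ultimately show ?case
    using colourable_extend[of "insert v V" v E 1] insert.hyps(1) by blast
qed

text \<open>A part of total degree at most 4 is split off and receives two new colours. The remaining part
  has lost \<open>5 = 4 + 1\<close> units of degree, which is the decrease of the bound when \<open>k\<close> drops by 2.\<close>

lemma colourable_if_total_deg_le:
  assumes "finite V" and asym: "\<And>u v. (u, v) \<in> E \<Longrightarrow> (v, u) \<notin> E"
    and "1 \<le> k" and "\<And>v. v \<in> V \<Longrightarrow> 2 * (total_deg E V v + 1) \<le> 5 * k"
  shows "colourable E V k"
  using assms(1,3,4)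
proof (induction k arbitrary: V rule: less_induct)
  case (less k)
  consider "k = 1" | "k = 2" | "3 \<le> k" using less.prems(2) by linarith
  then show ?case
  proof cases
    case 1
    have "total_deg E V v \<le> 1" if "v \<in> V" for v
      using less.prems(3)[OF that] 1 by simp
    then show ?thesis
      using colourable_1_if_total_deg_le_1[OF less.prems(1) asym] 1 by simp
  next
    case 2
    have "total_deg E V v \<le> 4" if "v \<in> V" for v
      using less.prems(3)[OF that] 2 by simp
    then show ?thesis
      using colourable_2_if_total_deg_le_4[OF less.prems(1) asym] 2 by simp
  next
    case 3
    \<comment> \<open>The largest total degree that \<open>k - 2\<close> colours can handle.\<close>
    define s where "s = (5 * (k - 2) - 2) div 2"
    have s: "2 * (s + 1) \<le> 5 * (k - 2)" "5 * k \<le> 2 * (s + 6) + 1" using 3 by (auto simp: s_def)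
    have deg: "total_deg E V v \<le> s + 4 + 1" if "v \<in> V" for v
      using less.prems(3)[OF that] s(2) by simp
    have "(v, v) \<notin> E" for v using asym[of v v] by blast
    then obtain A B where AB: "A \<union> B = V" "A \<inter> B = {}"
      "\<And>v. v \<in> A \<Longrightarrow> total_deg E A v \<le> s" "\<And>v. v \<in> B \<Longrightarrow> total_deg E B v \<le> 4"
      using degree_partition[OF less.prems(1) _ deg] by blast
    have fin: "finite A" "finite B" using AB(1) less.prems(1) by auto
    have "colourable E A (k - 2)"
    proof (rule less.IH[OF _ fin(1)])
      show "2 * (total_deg E A v + 1) \<le> 5 * (k - 2)" if "v \<in> A" for v
      proof -
        have "2 * (total_deg E A v + 1) \<le> 2 * (s + 1)" using AB(3)[OF that] by simp
        then show ?thesis using s(1) by (rule order_trans)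
      qed
    qed (use 3 in auto)
    moreover have "colourable E B 2"
      by (rule colourable_2_if_total_deg_le_4) (use fin(2) asym AB(4) in auto)
    ultimately have "colourable E (A \<union> B) (k - 2 + 2)" by (rule colourable_union)
    moreover have "k - 2 + 2 = k" using 3 by simp
    ultimately show ?thesis using AB(1) by simp
  qed
qed

section \<open>The geometric-mean degree\<close>

text \<open>Once all in- and out-degrees are at least \<open>k\<close>, a total degree of \<open>5/2 k - 1/2\<close> or more would make
  the product at least \<open>k (5/2 k - 1/2) - k\<^sup>2 = 3/2 k\<^sup>2 - 1/2 k\<close>, which for \<open>k \<ge> 1\<close> exceeds
  \<open>3/2 (k - 2/5)\<^sup>2 = 3/2 k\<^sup>2 - 6/5 k + 6/25\<close>.\<close>

lemma colourable_if_degree_product_less: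
  assumes "finite V" and asym: "\<And>u v. (u, v) \<in> E \<Longrightarrow> (v, u) \<notin> E" and "1 \<le> k"
    and "\<And>v. v \<in> V \<Longrightarrow>
      real (card (out_nbrs E V v) * card (in_nbrs E V v)) < 3 / 2 * (real k - 2 / 5)\<^sup>2"
  shows "colourable E V k"
  using assms(1,4)
proof (induction "card V" arbitrary: V rule: less_induct)
  case less
  show ?case
  proof (cases "\<exists>v\<in>V. card (out_nbrs E V v) < k \<or> card (in_nbrs E V v) < k")
    case True
    then obtain v where v: "v \<in> V" "card (out_nbrs E V v) < k \<or> card (in_nbrs E V v) < k" by blast
    have "colourable E (V - {v}) k"
    proof (rule less.hyps)
      show "card (V - {v}) < card V" using less.prems(1) v(1) by (metis card_Diff1_less)
      fix u assume u: "u \<in> V - {v}"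
      have "card (out_nbrs E (V - {v}) u) * card (in_nbrs E (V - {v}) u)
          \<le> card (out_nbrs E V u) * card (in_nbrs E V u)"
        by (intro mult_mono nbrs_card_mono less.prems) auto
      then have "real (card (out_nbrs E (V - {v}) u) * card (in_nbrs E (V - {v}) u))
          \<le> real (card (out_nbrs E V u) * card (in_nbrs E V u))" by (rule of_nat_mono)
      then show "real (card (out_nbrs E (V - {v}) u) * card (in_nbrs E (V - {v}) u)) < 3 / 2 * (real k - 2 / 5)\<^sup>2"
        by (rule order_le_less_trans) (use less.prems(2)[of u] u in simp)
    qed (use less.prems in auto)
    then show ?thesis
      using colourable_extend[OF less.prems(1) _ _ v(2)] asym[of v v] by blast
  next
    case False
    have "2 * (total_deg E V v + 1) \<le> 5 * k" if v: "v \<in> V" for v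
    proof (rule ccontr)
      let ?o = "real (card (out_nbrs E V v))" and ?i = "real (card (in_nbrs E V v))"
      assume "\<not> ?thesis"
      then have sum: "?o + ?i \<ge> 5 / 2 * k - 1 / 2" by (simp add: total_deg_def)
      have "0 \<le> (?o - k) * (?i - k)" using False v by (intro mult_nonneg_nonneg) auto
      then have "k * (?o + ?i) - k * k \<le> ?o * ?i" by (simp add: algebra_simps)
      moreover have "k * (5 / 2 * k - 1 / 2) \<le> k * (?o + ?i)" using sum by (intro mult_left_mono) auto
      moreover have "?o * ?i < 3 / 2 * (real k - 2 / 5)\<^sup>2" using less.prems(2)[OF v] by simp
      ultimately have "k * (5 / 2 * k - 1 / 2) - k * k < 3 / 2 * (real k - 2 / 5)\<^sup>2" by linarith
      then show False using assms(3) by (simp add: power2_eq_square algebra_simps)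
    qed
    then show ?thesis using colourable_if_total_deg_le[OF less.prems(1) asym assms(3)] by blast
  qed
qed

lemma (in wf_digraph) acyclic_set_if_acyclic_arcs:
  assumes "S \<subseteq> verts G" and "acyclic (Restr (arcs_ends G) S)"
  shows "acyclic_set G S"
  unfolding acyclic_set_def
proof (intro conjI notI)
  interpret S: wf_digraph "G \<restriction> S" by (rule wellformed_induce_subgraph)
  assume "\<exists>p. pre_digraph.cycle (G \<restriction> S) p"
  then obtain u p where "S.awalk u p u" "p \<noteq> []" by (auto simp: S.cycle_def)
  then have "(u, u) \<in> (arcs_ends (G \<restriction> S))\<^sup>+"
    using S.reachable1_awalk by blast
  moreover have "arcs_ends (G \<restriction> S) \<subseteq> Restr (arcs_ends G) S"
    by (auto simp: arcs_ends_conv)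
  ultimately have "(u, u) \<in> (Restr (arcs_ends G) S)\<^sup>+" by (meson subsetD trancl_mono)
  then show False using assms(2) by (simp add: acyclic_def)
qed (rule assms(1))

lemma (in digraph) chromatic_number_le_if_colourable:
  assumes "colourable (arcs_ends G) (verts G) k"
  shows "digraph_chromatic_number G \<le> k"
proof -
  obtain c where c: "\<forall>v\<in>verts G. c v < k" "acyclic_colouring (arcs_ends G) (verts G) c"
    using assms by (auto simp: colourable_def)
  define cls where "cls i = {v \<in> verts G. c v = i}" for i
  \<comment> \<open>Only the colours that occur give classes, since a partition has no empty block.\<close>
  define P where "P = cls ` c ` verts G"
  have "partition_on (verts G) P"
    by (rule partition_onI) (auto simp: P_def cls_def disjnt_def)
  moreover have fin: "finite P" by (simp add: P_def)
  moreover have "acyclic_set G S" if "S \<in> P" for S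
  proof (rule acyclic_set_if_acyclic_arcs)
    show "S \<subseteq> verts G" using that by (auto simp: P_def cls_def)
    show "acyclic (Restr (arcs_ends G) S)"
      using c(2) unfolding acyclic_colouring_def
      by (rule acyclic_subset) (use that in \<open>auto simp: P_def cls_def monochromatic_def\<close>)
  qed
  ultimately have "digraph_chromatic_number G \<le> card P"
    unfolding digraph_chromatic_number_def by (intro Least_le) blast
  also have "\<dots> \<le> card (c ` verts G)" unfolding P_def by (intro card_image_le) simp
  also have "\<dots> \<le> card {..<k}" by (rule card_mono) (use c(1) in auto)
  finally show ?thesis by simp
qed

lemma (in digraph) degrees_eq_card_nbrs:
  "out_degree G v = card (out_nbrs (arcs_ends G) (verts G) v)"
  "in_degree G v = card (in_nbrs (arcs_ends G) (verts G) v)"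
proof -
  have "bij_betw (head G) (out_arcs G v) (out_nbrs (arcs_ends G) (verts G) v)"
    unfolding bij_betw_def inj_on_def
    by (force simp: out_nbrs_def arcs_ends_conv intro: no_multi_arcs simp: arc_to_ends_def)
  then show "out_degree G v = card (out_nbrs (arcs_ends G) (verts G) v)"
    unfolding out_degree_def by (rule bij_betw_same_card)
  have "bij_betw (tail G) (in_arcs G v) (in_nbrs (arcs_ends G) (verts G) v)"
    unfolding bij_betw_def inj_on_def
    by (force simp: in_nbrs_def arcs_ends_conv intro: no_multi_arcs simp: arc_to_ends_def)
  then show "in_degree G v = card (in_nbrs (arcs_ends G) (verts G) v)"
    unfolding in_degree_def by (rule bij_betw_same_card)
qed

lemma (in oriented_graph) arcs_ends_asym:
  assumes "(u, v) \<in> arcs_ends G"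
  shows "(v, u) \<notin> arcs_ends G"
proof
  assume "(v, u) \<in> arcs_ends G"
  with assms obtain e f where ef: "e \<in> arcs G" "tail G e = u" "head G e = v"
    "f \<in> arcs G" "tail G f = v" "head G f = u"
    by (auto simp: arcs_ends_conv)
  then have "e = f" by (intro at_most_one_arc) auto
  with ef no_loops[of e] show False by auto
qed

theorem corollary1p5:
  fixes D :: "('a, 'b) pre_digraph"
  assumes "oriented_graph D"
  shows "int (digraph_chromatic_number D) \<le> \<lfloor>sqrt (2 / 3) * max_geom_degree D + 7 / 5\<rfloor>"
proof -
  interpret oriented_graph D by (rule assms)
  let ?\<Delta> = "max_geom_degree D"
  have \<Delta>: "sqrt (real (out_degree D v) * real (in_degree D v)) \<le> ?\<Delta>" if "v \<in> verts D" for v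
    unfolding max_geom_degree_def using that by (intro Max_ge) auto
  obtain w where "w \<in> verts D" using verts_nonempty by blast
  have "0 \<le> sqrt (real (out_degree D w) * real (in_degree D w))" by simp
  then have "0 \<le> ?\<Delta>" using \<Delta>[OF \<open>w \<in> verts D\<close>] by linarith
  define x where "x = sqrt (2 / 3) * ?\<Delta>"
  have "0 \<le> x" unfolding x_def using \<open>0 \<le> ?\<Delta>\<close> by (intro mult_nonneg_nonneg) simp_all
  define k where "k = nat \<lfloor>x + 7 / 5\<rfloor>"
  have floor: "1 \<le> \<lfloor>x + 7 / 5\<rfloor>" using \<open>0 \<le> x\<close> by (simp add: le_floor_iff)
  then have k: "int k = \<lfloor>x + 7 / 5\<rfloor>" unfolding k_def by linarith
  with floor have "1 \<le> k" by linarith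
  have "x + 7 / 5 < of_int \<lfloor>x + 7 / 5\<rfloor> + 1" by linarith
  also have "of_int \<lfloor>x + 7 / 5\<rfloor> = real k" using k by (metis of_int_of_nat_eq)
  finally have gap: "x < real k - 2 / 5" by linarith
  have "colourable (arcs_ends D) (verts D) k"
  proof (rule colourable_if_degree_product_less)
    fix v assume v: "v \<in> verts D"
    let ?p = "real (out_degree D v) * real (in_degree D v)"
    have "sqrt (2 / 3) * sqrt ?p < real k - 2 / 5"
    proof -
      have "sqrt (2 / 3) * sqrt ?p \<le> x" unfolding x_def by (intro mult_left_mono \<Delta> v) simp
      with gap show ?thesis by linarith
    qed
    then have "(sqrt (2 / 3) * sqrt ?p)\<^sup>2 < (real k - 2 / 5)\<^sup>2"
      by (intro power_strict_mono) auto
    then have "2 / 3 * ?p < (real k - 2 / 5)\<^sup>2" by (simp add: power_mult_distrib)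
    then show "real (card (out_nbrs (arcs_ends D) (verts D) v) * card (in_nbrs (arcs_ends D) (verts D) v))
        < 3 / 2 * (real k - 2 / 5)\<^sup>2"
      by (simp add: degrees_eq_card_nbrs)
  qed (use \<open>1 \<le> k\<close> arcs_ends_asym in auto)
  then have "digraph_chromatic_number D \<le> k" by (rule chromatic_number_le_if_colourable)
  then have "int (digraph_chromatic_number D) \<le> int k" by simp
  then show ?thesis using k by (simp only: x_def)
qed

end
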